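(* Let $M_G$ be a mixed graph with $n$ vertices, and let $G$ be its underlying graph with $m$ edges and vertex degrees $d_1,\dots,d_n$. Then for any $\alpha\in[0,1]$, the largest eigenvalue $\mu_{\max}(A_\alpha)$ and the smallest eigenvalue $\mu_{\min}(A_\alpha)$ of the matrix $A_\alpha$ of $M_G$ satisfy $$\mu_{\max}(A_\alpha)\le\frac{2\alpha m+\sqrt{(n-1)\left[n\alpha^2\sum_{i=1}^n d_i^2+2mn(1-\alpha)^2-4\alpha^2m^2\right]}}{n}$$ and $$\mu_{\min}(A_\alpha)\ge\frac{2\alpha m-\sqrt{(n-1)\left[n\alpha^2\sum_{i=1}^n d_i^2+2mn(1-\alpha)^2-4\alpha^2m^2\right]}}{n}.$$
   Context: A mixed graph $M_G=(V,E,A)$ consists of a vertex set $V=\{v_1,\dots,v_n\}$, a set $E$ of undirected edges and a set $A$ of directed edges (arcs). All mixed graphs are finite and simple (no loops, no multiple edges or arcs), so any two distinct vertices are joined by at most one undirected edge or arc. The underlying graph $G$ is the simple undirected graph obtained by forgetting the directions of the arcs; its number of edges $m$ is thus the total number of undirected edges and arcs. The degree $d_i$ of $v_i$ is its degree in $G$, and $D=\mathrm{diag}(d_1,\dots,d_n)$. Let $\omega=\frac{1+i\sqrt3}{2}$. The Hermitian adjacency matrix of the second kind $H^\omega$ is the $n\times n$ matrix with $(v,u)$ entry equal to $\omega$ if there is an arc from $v$ to $u$, $\bar\omega$ if there is an arc from $u$ to $v$, $1$ if $\{v,u\}$ is an undirected edge, and $0$ otherwise. For $\alpha\in[0,1]$,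 $A_\alpha=\alpha D+(1-\alpha)H^\omega$, a Hermitian matrix, whose eigenvalues are real. *)

theory Defs
  imports Complex_Main "Jordan_Normal_Form.Spectral_Radius"
begin

record 'a mixed_graph =
  mverts :: "'a set"
  medges :: "'a set set"
  marcs  :: "('a \<times> 'a) set"

text \<open>
  Simplicity of the underlying graph: between two distinct vertices there is at most one of an
  undirected edge, an arc, and the opposite arc. Repeated edges or arcs are excluded because
  \<open>medges\<close> and \<open>marcs\<close> are sets.
\<close>

locale mixed_graph =
  fixes M :: "'a mixed_graph"
  assumes finite_mverts: "finite (mverts M)"
    and medges_wf: "e \<in> medges M \<Longrightarrow> e \<subseteq> mverts M \<and> card e = 2"
    and marcs_wf: "(u, w) \<in> marcs M \<Longrightarrow> u \<in> mverts M \<and> w \<in> mverts M \<and> u \<noteq> w"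
    and marcs_antiparallel: "(u, w) \<in> marcs M \<Longrightarrow> (w, u) \<notin> marcs M"
    and marcs_medges_disjoint: "(u, w) \<in> marcs M \<Longrightarrow> {u, w} \<notin> medges M"

definition underlying_edges :: "'a mixed_graph \<Rightarrow> 'a set set" where
  "underlying_edges M = medges M \<union> {{u, w} | u w. (u, w) \<in> marcs M}"

definition udegree :: "'a mixed_graph \<Rightarrow> 'a \<Rightarrow> nat" where
  "udegree M x = card {e \<in> underlying_edges M. x \<in> e}"

definition omega :: complex where
  "omega = (1 + \<i> * complex_of_real (sqrt 3)) / 2"

definition hermitian_entry :: "'a mixed_graph \<Rightarrow> 'a \<Rightarrow> 'a \<Rightarrow> complex" where
  "hermitian_entry M u w =
     (if (u, w) \<in> marcs M then omega
      else if (w, u) \<in> marcs M then cnj omega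
      else if {u, w} \<in> medges M then 1
      else 0)"

text \<open>
  In the matrices below, \<open>v 0, \<dots>, v (n - 1)\<close> is an enumeration of the vertices, so rows and columns
  are indexed from \<open>0\<close>.
\<close>

definition hermitian_adj_mat :: "nat \<Rightarrow> (nat \<Rightarrow> 'a) \<Rightarrow> 'a mixed_graph \<Rightarrow> complex mat" where
  "hermitian_adj_mat n v M = mat n n (\<lambda>(i, j). hermitian_entry M (v i) (v j))"

definition degree_mat :: "nat \<Rightarrow> (nat \<Rightarrow> 'a) \<Rightarrow> 'a mixed_graph \<Rightarrow> complex mat" where
  "degree_mat n v M = mat_diag n (\<lambda>i. of_nat (udegree M (v i)))"

definition A_alpha :: "real \<Rightarrow> nat \<Rightarrow> (nat \<Rightarrow> 'a) \<Rightarrow> 'a mixed_graph \<Rightarrow> complex mat" where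
  "A_alpha \<alpha> n v M =
     complex_of_real \<alpha> \<cdot>\<^sub>m degree_mat n v M + complex_of_real (1 - \<alpha>) \<cdot>\<^sub>m hermitian_adj_mat n v M"

text \<open>
  Largest and smallest eigenvalue of a complex matrix whose spectrum is real, as is the case for
  \<open>A_alpha\<close> (lemma \<open>spectrum_A_alpha_real\<close>); \<open>Re\<close> then only converts the type.
  For \<open>n > 0\<close> the spectrum is finite and nonempty.
\<close>

definition mu_max :: "complex mat \<Rightarrow> real" where
  "mu_max B = Max (Re ` spectrum B)"

definition mu_min :: "complex mat \<Rightarrow> real" where
  "mu_min B = Min (Re ` spectrum B)"

lemma A_alpha_carrier [simp]: "A_alpha \<alpha> n v M \<in> carrier_mat n n"
  by (auto simp: A_alpha_def hermitian_adj_mat_def degree_mat_def)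

context mixed_graph
begin

lemma hermitian_entry_cnj: "cnj (hermitian_entry M u w) = hermitian_entry M w u"
  using marcs_antiparallel by (auto simp: hermitian_entry_def insert_commute)

lemma A_alpha_hermitian:
  assumes "i < n" "j < n"
  shows "cnj (A_alpha \<alpha> n v M $$ (i, j)) = A_alpha \<alpha> n v M $$ (j, i)"
  using assms
  by (auto simp: A_alpha_def hermitian_adj_mat_def degree_mat_def mat_diag_def hermitian_entry_cnj)

lemma spectrum_A_alpha_real:
  assumes "k \<in> spectrum (A_alpha \<alpha> n v M)"
  shows "k \<in> \<real>"
proof -
  define B where "B = A_alpha \<alpha> n v M"
  have B: "B \<in> carrier_mat n n" by (simp add: B_def)
  obtain x where x: "x \<in> carrier_vec n" "x \<noteq> 0\<^sub>v n" "B *\<^sub>v x = k \<cdot>\<^sub>v x"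
    using assms B by (auto simp: spectrum_def eigenvalue_def eigenvector_def B_def[symmetric])
  define N where "N = (\<Sum>i<n. (cmod (x $ i))\<^sup>2)"
  define S where "S = (\<Sum>i<n. \<Sum>j<n. cnj (x $ i) * B $$ (i, j) * x $ j)"
  have row: "(\<Sum>j<n. B $$ (i, j) * x $ j) = k * x $ i" if "i < n" for i
  proof -
    have "(B *\<^sub>v x) $ i = (\<Sum>j<n. B $$ (i, j) * x $ j)"
      using that B x(1) by (auto simp: scalar_prod_def atLeast0LessThan intro!: sum.cong)
    then show ?thesis using x that by simp
  qed
  have "S = (\<Sum>i<n. cnj (x $ i) * (\<Sum>j<n. B $$ (i, j) * x $ j))"
    by (simp add: S_def sum_distrib_left mult.assoc)
  also have "\<dots> = (\<Sum>i<n. k * complex_of_real ((cmod (x $ i))\<^sup>2))"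
    by (intro sum.cong refl) (simp only: row lessThan_iff, simp only: complex_norm_square mult_ac)
  finally have SN: "S = k * complex_of_real N"
    by (simp add: N_def sum_distrib_left)
  have "cnj S = (\<Sum>i<n. \<Sum>j<n. x $ i * B $$ (j, i) * cnj (x $ j))"
    unfolding S_def cnj_sum
    by (intro sum.cong refl) (simp add: B_def A_alpha_hermitian)
  also have "\<dots> = S"
    unfolding S_def by (subst sum.swap) (simp add: mult_ac)
  finally have "cnj k * complex_of_real N = k * complex_of_real N"
    using SN by simp
  moreover have "N \<noteq> 0"
  proof
    assume "N = 0"
    then have "\<forall>i<n. x $ i = 0"
      by (auto simp: N_def sum_nonneg_eq_0_iff)
    then have "x = 0\<^sub>v n" using x(1) by (intro eq_vecI) auto
    with x(2) show False by simp
  qed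
  ultimately show ?thesis
    by (simp add: Reals_cnj_iff)
qed

end

end

theory Submission
  imports Defs "HOL-Analysis.Convex"
begin

text \<open>
  Both bounds come from one inequality: an eigenvalue \<open>k\<close> of a complex \<open>n \<times> n\<close> matrix \<open>B\<close> satisfies
  \<open>\<bar>n k - tr B\<bar>\<^sup>2 \<le> (n - 1) (n \<parallel>B\<parallel>\<^sup>2 - \<bar>tr B\<bar>\<^sup>2)\<close>, where \<open>\<parallel>B\<parallel>\<close> is the Frobenius norm
  (\<open>eigenvalue_trace_bound\<close>).

  For Hermitian \<open>B\<close> one usually derives this from \<open>tr B = \<Sum> \<mu>\<^sub>i\<close> and \<open>\<parallel>B\<parallel>\<^sup>2 = \<Sum> \<mu>\<^sub>i\<^sup>2\<close> by applying
  Cauchy--Schwarz to the remaining \<open>n - 1\<close> eigenvalues. The argument here avoids diagonalisation: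
  if \<open>x\<close> is a unit eigenvector, then \<open>k\<close> is the Frobenius inner product of \<open>B\<close> with the rank-one
  projection \<open>x x\<^sup>*\<close>. Subtracting from both matrices their multiples of the identity,
  Cauchy--Schwarz for the traceless parts (\<open>traceless_Cauchy_Schwarz\<close>) gives the inequality. The
  factor \<open>n - 1\<close> arises because \<open>x x\<^sup>*\<close> has trace and norm \<open>1\<close>, so that its traceless part has
  squared norm \<open>1 - 1/n\<close>.

  For \<open>A_alpha\<close> both quantities are combinatorial. The Hermitian adjacency matrix has zero
  diagonal, so the handshake lemma gives the trace \<open>2 \<alpha> m\<close>. Its nonzero entries have modulus \<open>1\<close> and
  row \<open>i\<close> contains \<open>d\<^sub>i\<close> of them, so the squared Frobenius norm of \<open>A_alpha\<close> is
  \<open>\<alpha>\<^sup>2 \<Sum> d\<^sub>i\<^sup>2 + 2 m (1 - \<alpha>)\<^sup>2\<close>.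
\<close>

section \<open>Eigenvalues, trace and Frobenius norm\<close>

text \<open>
  The traceless part of \<open>b\<close> is \<open>b - (tr b / n) I\<close>; scaling it by \<open>n\<close> avoids the division. The
  sum is bilinear, without conjugation, so that one identity yields both the inner product needed
  below and, with \<open>p\<close> the entrywise conjugate of \<open>b\<close>, the norm.
\<close>

lemma sum_traceless_parts:
  fixes n :: nat and b p :: "nat \<Rightarrow> nat \<Rightarrow> complex"
  defines "s \<equiv> (\<Sum>k<n. b k k)" and "t \<equiv> (\<Sum>k<n. p k k)"
  shows "(\<Sum>i<n. \<Sum>j<n. (of_nat n * b i j - (if i = j then s else 0)) *
                          (of_nat n * p i j - (if i = j then t else 0))) =
         of_nat n * (of_nat n * (\<Sum>i<n. \<Sum>j<n. b i j * p i j) - s * t)"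
proof -
  have expand: "(of_nat n * b i j - (if i = j then s else 0)) *
                (of_nat n * p i j - (if i = j then t else 0)) =
      of_nat n * of_nat n * (b i j * p i j)
      + (if j = i then s * t - of_nat n * t * b i i - of_nat n * s * p i i else 0)" for i j
    by (auto simp: algebra_simps)
  have "(\<Sum>i<n. \<Sum>j<n. (of_nat n * b i j - (if i = j then s else 0)) *
                          (of_nat n * p i j - (if i = j then t else 0))) =
      of_nat n * of_nat n * (\<Sum>i<n. \<Sum>j<n. b i j * p i j)
      + (\<Sum>i<n. s * t - of_nat n * t * b i i - of_nat n * s * p i i)"
    unfolding expand by (simp add: sum.distrib sum_distrib_left)
  also have "(\<Sum>i<n. s * t - of_nat n * t * b i i - of_nat n * s * p i i) =
      of_nat n * (s * t) - of_nat n * t * s - of_nat n * s * t"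
    by (simp add: sum_subtractf s_def t_def flip: sum_distrib_left)
  finally show ?thesis by (simp add: algebra_simps)
qed

lemma sum_traceless_part_norm:
  fixes n :: nat and b :: "nat \<Rightarrow> nat \<Rightarrow> complex"
  defines "s \<equiv> (\<Sum>k<n. b k k)"
  shows "(\<Sum>i<n. \<Sum>j<n. (cmod (of_nat n * b i j - (if i = j then s else 0)))\<^sup>2) =
         real n * (real n * (\<Sum>i<n. \<Sum>j<n. (cmod (b i j))\<^sup>2) - (cmod s)\<^sup>2)"
proof -
  have "of_nat n * cnj z - (if i = j then cnj s else 0) =
        cnj (of_nat n * z - (if i = j then s else 0))" for z and i j :: nat
    by simp
  then have "complex_of_real (\<Sum>i<n. \<Sum>j<n. (cmod (of_nat n * b i j - (if i = j then s else 0)))\<^sup>2) =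
        complex_of_real (real n * (real n * (\<Sum>i<n. \<Sum>j<n. (cmod (b i j))\<^sup>2) - (cmod s)\<^sup>2))"
    using sum_traceless_parts[of n b "\<lambda>i j. cnj (b i j)"]
    unfolding s_def by (simp only: of_real_sum complex_norm_square of_real_mult of_real_diff
        of_real_of_nat_eq cnj_sum)
  then show ?thesis by (simp only: of_real_eq_iff)
qed

text \<open>
  This sharpens Cauchy--Schwarz for the Frobenius inner product: each term is \<open>n\<close> times the one that
  belongs to the traceless parts, since these are orthogonal to the identity matrix.
\<close>

lemma traceless_Cauchy_Schwarz:
  fixes n :: nat and b p :: "nat \<Rightarrow> nat \<Rightarrow> complex"
  assumes "n > 0"
  defines "s \<equiv> (\<Sum>k<n. b k k)" and "t \<equiv> (\<Sum>k<n. p k k)"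
  shows "(cmod (of_nat n * (\<Sum>i<n. \<Sum>j<n. b i j * p i j) - s * t))\<^sup>2 \<le>
         (real n * (\<Sum>i<n. \<Sum>j<n. (cmod (b i j))\<^sup>2) - (cmod s)\<^sup>2) *
         (real n * (\<Sum>i<n. \<Sum>j<n. (cmod (p i j))\<^sup>2) - (cmod t)\<^sup>2)"
    (is "(cmod ?I)\<^sup>2 \<le> ?B * ?P")
proof -
  define b' where "b' = (\<lambda>(i, j). of_nat n * b i j - (if i = j then s else 0))"
  define p' where "p' = (\<lambda>(i, j). of_nat n * p i j - (if i = j then t else 0))"
  let ?S = "{..<n} \<times> {..<n}"
  have inner: "(\<Sum>e\<in>?S. b' e * p' e) = of_nat n * ?I"
    using sum_traceless_parts[of n b p]
    unfolding b'_def p'_def s_def t_def by (simp add: sum.cartesian_product case_prod_unfold)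
  have norms: "(\<Sum>e\<in>?S. (cmod (b' e))\<^sup>2) = real n * ?B" "(\<Sum>e\<in>?S. (cmod (p' e))\<^sup>2) = real n * ?P"
    using sum_traceless_part_norm[of n b] sum_traceless_part_norm[of n p]
    unfolding b'_def p'_def s_def t_def by (simp_all add: sum.cartesian_product case_prod_unfold)
  have "cmod (of_nat n * ?I) \<le> (\<Sum>e\<in>?S. cmod (b' e) * cmod (p' e))"
    unfolding inner[symmetric] by (rule order_trans[OF norm_sum]) (simp add: norm_mult)
  then have "(cmod (of_nat n * ?I))\<^sup>2 \<le> (\<Sum>e\<in>?S. cmod (b' e) * cmod (p' e))\<^sup>2"
    by (intro power_mono) auto
  also have "\<dots> \<le> (real n * ?B) * (real n * ?P)"
    unfolding norms[symmetric] by (rule Cauchy_Schwarz_ineq_sum)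
  finally have "(real n)\<^sup>2 * (cmod ?I)\<^sup>2 \<le> (real n)\<^sup>2 * (?B * ?P)"
    by (simp add: norm_mult power_mult_distrib power2_eq_square mult_ac)
  then show ?thesis
    using \<open>n > 0\<close> by (subst (asm) mult_le_cancel_left_pos) auto
qed

text \<open>
  The inequality \<open>traceless_Cauchy_Schwarz\<close> is applied to \<open>B\<close> and the conjugate of \<open>x x\<^sup>*\<close>, where \<open>x\<close>
  is an eigenvector for \<open>k\<close>. With \<open>N = \<parallel>x\<parallel>\<^sup>2\<close> the inner product is \<open>x\<^sup>* B x = k N\<close>, the trace is \<open>N\<close> and
  the squared Frobenius norm is \<open>N\<^sup>2\<close>, so \<open>N\<^sup>2\<close> cancels and \<open>x\<close> can stay unnormalised.
\<close>

lemma eigenvalue_trace_bound: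
  fixes B :: "complex mat"
  assumes B: "B \<in> carrier_mat n n" and ev: "eigenvalue B k"
  defines "t \<equiv> (\<Sum>i<n. B $$ (i, i))"
  shows "(cmod (of_nat n * k - t))\<^sup>2 \<le>
         (real n - 1) * (real n * (\<Sum>i<n. \<Sum>j<n. (cmod (B $$ (i, j)))\<^sup>2) - (cmod t)\<^sup>2)"
proof -
  obtain x where x: "x \<in> carrier_vec n" "x \<noteq> 0\<^sub>v n" "B *\<^sub>v x = k \<cdot>\<^sub>v x"
    using ev B by (auto simp: eigenvalue_def eigenvector_def)
  define N where "N = (\<Sum>i<n. (cmod (x $ i))\<^sup>2)"
  have n: "n > 0" using x(1,2) by (cases "n = 0") auto
  have "N \<noteq> 0"
  proof
    assume "N = 0"
    then have "\<forall>i<n. x $ i = 0"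
      by (auto simp: N_def sum_nonneg_eq_0_iff)
    then have "x = 0\<^sub>v n" using x(1) by (intro eq_vecI) auto
    with x(2) show False by simp
  qed
  have row: "(\<Sum>j<n. B $$ (i, j) * x $ j) = k * x $ i" if "i < n" for i
  proof -
    have "(B *\<^sub>v x) $ i = (\<Sum>j<n. B $$ (i, j) * x $ j)"
      using that B x(1) by (auto simp: scalar_prod_def atLeast0LessThan intro!: sum.cong)
    then show ?thesis using x that by simp
  qed
  define p where "p = (\<lambda>i j. cnj (x $ i) * x $ j)"
  have "(\<Sum>i<n. \<Sum>j<n. B $$ (i, j) * p i j) = (\<Sum>i<n. cnj (x $ i) * (\<Sum>j<n. B $$ (i, j) * x $ j))"
    by (simp add: p_def sum_distrib_left mult_ac)
  also have "\<dots> = (\<Sum>i<n. k * complex_of_real ((cmod (x $ i))\<^sup>2))"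
    by (intro sum.cong refl) (simp only: row lessThan_iff, simp only: complex_norm_square mult_ac)
  finally have inner: "(\<Sum>i<n. \<Sum>j<n. B $$ (i, j) * p i j) = k * complex_of_real N"
    by (simp add: N_def sum_distrib_left)
  have trace_p: "(\<Sum>i<n. p i i) = complex_of_real N"
    unfolding p_def N_def of_real_sum by (simp only: complex_norm_square mult_ac)
  have norm_p: "(\<Sum>i<n. \<Sum>j<n. (cmod (p i j))\<^sup>2) = N\<^sup>2"
    by (simp add: p_def N_def norm_mult power_mult_distrib power2_eq_square[of "sum _ _"] sum_product)
  have "(cmod (of_nat n * (k * complex_of_real N) - t * complex_of_real N))\<^sup>2 \<le>
      (real n * (\<Sum>i<n. \<Sum>j<n. (cmod (B $$ (i, j)))\<^sup>2) - (cmod t)\<^sup>2) * (real n * N\<^sup>2 - N\<^sup>2)"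
    using traceless_Cauchy_Schwarz[OF n, of "\<lambda>i j. B $$ (i, j)" p]
    unfolding inner trace_p norm_p t_def[symmetric] by simp
  also have "of_nat n * (k * complex_of_real N) - t * complex_of_real N =
      complex_of_real N * (of_nat n * k - t)"
    by (simp add: algebra_simps)
  finally have "N\<^sup>2 * (cmod (of_nat n * k - t))\<^sup>2 \<le> N\<^sup>2 *
      ((real n - 1) * (real n * (\<Sum>i<n. \<Sum>j<n. (cmod (B $$ (i, j)))\<^sup>2) - (cmod t)\<^sup>2))"
    unfolding norm_mult power_mult_distrib by (simp add: algebra_simps)
  then show ?thesis
    using \<open>N \<noteq> 0\<close> by (subst (asm) mult_le_cancel_left_pos) auto
qed

section \<open>Degrees and the entries of the Hermitian adjacency matrix\<close>

lemma cmod_omega: "cmod omega = 1"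
  by (simp add: omega_def cmod_def power_divide)

context mixed_graph
begin

lemma underlying_edge_wf:
  assumes "e \<in> underlying_edges M"
  shows "e \<subseteq> mverts M" "card e = 2"
  using assms medges_wf marcs_wf by (auto simp: underlying_edges_def)

lemma finite_underlying_edges: "finite (underlying_edges M)"
proof (rule finite_subset)
  show "underlying_edges M \<subseteq> Pow (mverts M)"
    using underlying_edge_wf(1) by auto
  show "finite (Pow (mverts M))"
    using finite_mverts by simp
qed

text \<open>The handshake lemma: count the pairs of a vertex and an edge containing it.\<close>

lemma sum_udegree: "(\<Sum>x\<in>mverts M. udegree M x) = 2 * card (underlying_edges M)"
  unfolding udegree_def
proof (rule sum_multicount[OF finite_mverts finite_underlying_edges], intro ballI)
  fix e assume e: "e \<in> underlying_edges M"
  have "{x \<in> mverts M. x \<in> e} = e"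
    using underlying_edge_wf(1)[OF e] by auto
  then show "card {x \<in> mverts M. x \<in> e} = 2"
    using underlying_edge_wf(2)[OF e] by simp
qed

lemma cmod_hermitian_entry:
  "cmod (hermitian_entry M u w) = (if {u, w} \<in> underlying_edges M then 1 else 0)"
proof -
  have "{u, w} \<in> underlying_edges M \<longleftrightarrow>
      (u, w) \<in> marcs M \<or> (w, u) \<in> marcs M \<or> {u, w} \<in> medges M"
    unfolding underlying_edges_def by (auto simp: doubleton_eq_iff)
  then show ?thesis by (simp add: hermitian_entry_def cmod_omega)
qed

text \<open>A nonzero diagonal entry would require the singleton \<open>{u}\<close> to be an edge.\<close>

lemma hermitian_entry_diag: "hermitian_entry M u u = 0"
  using underlying_edge_wf(2)[of "{u, u}"] cmod_hermitian_entry[of u u] by (auto split: if_splits)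

text \<open>
  The degree counts edges, whereas a matrix row is indexed by vertices; in a simple graph an edge at
  \<open>u\<close> is determined by its other end.
\<close>

lemma udegree_eq_card_neighbours:
  "udegree M u = card {w \<in> mverts M. {u, w} \<in> underlying_edges M}"
proof -
  have "bij_betw (\<lambda>w. {u, w}) {w \<in> mverts M. {u, w} \<in> underlying_edges M}
      {e \<in> underlying_edges M. u \<in> e}"
  proof (rule bij_betw_imageI)
    show "inj_on (\<lambda>w. {u, w}) {w \<in> mverts M. {u, w} \<in> underlying_edges M}"
      by (auto simp: inj_on_def doubleton_eq_iff)
    have "e \<in> (\<lambda>w. {u, w}) ` {w \<in> mverts M. {u, w} \<in> underlying_edges M}"
      if e: "e \<in> underlying_edges M" "u \<in> e" for e
    proof -
      obtain w where "e = {u, w}"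
        using underlying_edge_wf(2)[OF e(1)] e(2) by (auto simp: card_2_iff)
      with e underlying_edge_wf(1)[OF e(1)] show ?thesis by auto
    qed
    then show "(\<lambda>w. {u, w}) ` {w \<in> mverts M. {u, w} \<in> underlying_edges M} =
        {e \<in> underlying_edges M. u \<in> e}"
      by auto
  qed
  then show ?thesis
    unfolding udegree_def by (simp add: bij_betw_same_card)
qed

lemma sum_cmod_hermitian_entry:
  "(\<Sum>w\<in>mverts M. (cmod (hermitian_entry M u w))\<^sup>2) = real (udegree M u)"
proof -
  have "(\<Sum>w\<in>mverts M. (cmod (hermitian_entry M u w))\<^sup>2) =
      (\<Sum>w\<in>mverts M. if {u, w} \<in> underlying_edges M then 1 else 0)"
    by (intro sum.cong) (auto simp: cmod_hermitian_entry)
  then show ?thesis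
    using finite_mverts by (simp add: udegree_eq_card_neighbours flip: sum.inter_filter)
qed

section \<open>The matrix \<open>A_alpha\<close>\<close>

lemma trace_A_alpha:
  assumes "bij_betw v {..<n} (mverts M)"
  shows "(\<Sum>i<n. A_alpha \<alpha> n v M $$ (i, i)) =
    complex_of_real (2 * \<alpha> * real (card (underlying_edges M)))"
proof -
  have "(\<Sum>i<n. A_alpha \<alpha> n v M $$ (i, i)) = (\<Sum>i<n. complex_of_real \<alpha> * of_nat (udegree M (v i)))"
    by (intro sum.cong refl)
      (auto simp: A_alpha_def hermitian_adj_mat_def degree_mat_def mat_diag_def hermitian_entry_diag)
  also have "\<dots> = complex_of_real \<alpha> * of_nat (\<Sum>i<n. udegree M (v i))"
    by (simp add: sum_distrib_left)
  also have "(\<Sum>i<n. udegree M (v i)) = 2 * card (underlying_edges M)"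
    using sum.reindex_bij_betw[OF assms, of "udegree M"] sum_udegree by simp
  finally show ?thesis by simp
qed

text \<open>
  The degree matrix and the Hermitian adjacency matrix have disjoint supports, so their squared
  norms add up. That of the Hermitian adjacency matrix itself is \<open>\<Sum> d\<^sub>i = 2 m\<close>.
\<close>

lemma frobenius_norm_A_alpha:
  assumes "bij_betw v {..<n} (mverts M)"
  shows "(\<Sum>i<n. \<Sum>j<n. (cmod (A_alpha \<alpha> n v M $$ (i, j)))\<^sup>2) =
    \<alpha>\<^sup>2 * (\<Sum>i<n. (real (udegree M (v i)))\<^sup>2)
    + 2 * real (card (underlying_edges M)) * (1 - \<alpha>)\<^sup>2"
proof -
  have entry: "(cmod (A_alpha \<alpha> n v M $$ (i, j)))\<^sup>2 =
      (if j = i then \<alpha>\<^sup>2 * (real (udegree M (v i)))\<^sup>2 else 0)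
      + (1 - \<alpha>)\<^sup>2 * (cmod (hermitian_entry M (v i) (v j)))\<^sup>2"
    if "i < n" "j < n" for i j
    using that
    by (auto simp: A_alpha_def hermitian_adj_mat_def degree_mat_def mat_diag_def
        hermitian_entry_diag norm_mult power_mult_distrib simp del: of_real_diff)
  have "(\<Sum>i<n. \<Sum>j<n. (cmod (A_alpha \<alpha> n v M $$ (i, j)))\<^sup>2) =
      (\<Sum>i<n. \<alpha>\<^sup>2 * (real (udegree M (v i)))\<^sup>2
        + (1 - \<alpha>)\<^sup>2 * (\<Sum>j<n. (cmod (hermitian_entry M (v i) (v j)))\<^sup>2))"
    by (intro sum.cong refl) (simp add: entry sum.distrib sum_distrib_left)
  also have "\<dots> = (\<Sum>i<n. \<alpha>\<^sup>2 * (real (udegree M (v i)))\<^sup>2 + (1 - \<alpha>)\<^sup>2 * real (udegree M (v i)))"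
    using sum.reindex_bij_betw[OF assms, of "\<lambda>w. (cmod (hermitian_entry M u w))\<^sup>2" for u]
    by (simp add: sum_cmod_hermitian_entry)
  also have "\<dots> = \<alpha>\<^sup>2 * (\<Sum>i<n. (real (udegree M (v i)))\<^sup>2)
      + (1 - \<alpha>)\<^sup>2 * real (\<Sum>i<n. udegree M (v i))"
    by (simp add: sum.distrib sum_distrib_left)
  also have "(\<Sum>i<n. udegree M (v i)) = 2 * card (underlying_edges M)"
    using sum.reindex_bij_betw[OF assms, of "udegree M"] sum_udegree by simp
  finally show ?thesis by (simp add: mult_ac)
qed

end

theorem theorem3p5:
  fixes M :: "'a mixed_graph" and n m :: nat and v :: "nat \<Rightarrow> 'a" and d :: "nat \<Rightarrow> nat"
    and \<alpha> :: real
  assumes "mixed_graph M"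
    and "n \<ge> 1"
    and "bij_betw v {..<n} (mverts M)"
    and "m = card (underlying_edges M)"
    and "\<And>i. i < n \<Longrightarrow> d i = udegree M (v i)"
    and "0 \<le> \<alpha>" and "\<alpha> \<le> 1"
  shows "mu_max (A_alpha \<alpha> n v M) \<le>
           (2 * \<alpha> * real m + sqrt ((real n - 1) *
              (real n * \<alpha>\<^sup>2 * (\<Sum>i<n. (real (d i))\<^sup>2)
                + 2 * real m * real n * (1 - \<alpha>)\<^sup>2 - 4 * \<alpha>\<^sup>2 * (real m)\<^sup>2))) / real n
       \<and> mu_min (A_alpha \<alpha> n v M) \<ge>
           (2 * \<alpha> * real m - sqrt ((real n - 1) *
              (real n * \<alpha>\<^sup>2 * (\<Sum>i<n. (real (d i))\<^sup>2)
                + 2 * real m * real n * (1 - \<alpha>)\<^sup>2 - 4 * \<alpha>\<^sup>2 * (real m)\<^sup>2))) / real n"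
    (is "_ \<le> (_ + sqrt ?R) / _ \<and> _")
proof -
  interpret mixed_graph M by fact
  define B where "B = A_alpha \<alpha> n v M"
  have B: "B \<in> carrier_mat n n" by (simp add: B_def)
  have frobenius: "(\<Sum>i<n. \<Sum>j<n. (cmod (B $$ (i, j)))\<^sup>2) =
      \<alpha>\<^sup>2 * (\<Sum>i<n. (real (d i))\<^sup>2) + 2 * real m * (1 - \<alpha>)\<^sup>2"
    unfolding B_def frobenius_norm_A_alpha[OF assms(3)] assms(4) using assms(5) by simp
  have trace: "(\<Sum>i<n. B $$ (i, i)) = complex_of_real (2 * \<alpha> * real m)"
    unfolding B_def assms(4) by (rule trace_A_alpha[OF assms(3)])
  \<comment> \<open>One estimate of \<open>\<bar>n k - tr B\<bar>\<close>, uniform over the spectrum, contains the upper and the lower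
    bound.\<close>
  have bound: "\<bar>real n * Re k - 2 * \<alpha> * real m\<bar> \<le> sqrt ?R" if "k \<in> spectrum B" for k
  proof -
    have "(cmod (of_nat n * k - complex_of_real (2 * \<alpha> * real m)))\<^sup>2 \<le>
        (real n - 1) * (real n * (\<alpha>\<^sup>2 * (\<Sum>i<n. (real (d i))\<^sup>2) + 2 * real m * (1 - \<alpha>)\<^sup>2)
          - (cmod (complex_of_real (2 * \<alpha> * real m)))\<^sup>2)"
      using eigenvalue_trace_bound[OF B, of k] that
      unfolding frobenius trace by (simp add: spectrum_def)
    also have "\<dots> = ?R"
      by (simp only: norm_of_real power2_abs) (simp add: distrib_left power_mult_distrib mult_ac)
    finally have "cmod (of_nat n * k - complex_of_real (2 * \<alpha> * real m)) \<le> sqrt ?R"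
      by (rule real_le_rsqrt)
    moreover have "\<bar>real n * Re k - 2 * \<alpha> * real m\<bar> \<le>
        cmod (of_nat n * k - complex_of_real (2 * \<alpha> * real m))"
      using abs_Re_le_cmod[of "of_nat n * k - complex_of_real (2 * \<alpha> * real m)"] by simp
    ultimately show ?thesis by (rule order_trans[rotated])
  qed
  have fin: "finite (Re ` spectrum B)" and ne: "Re ` spectrum B \<noteq> {}"
    using card_finite_spectrum(1)[OF B] spectrum_non_empty[OF B] assms(2) by auto
  have "mu_max B \<in> Re ` spectrum B" "mu_min B \<in> Re ` spectrum B"
    unfolding mu_max_def mu_min_def using fin ne by (auto intro: Max_in Min_in)
  then have "\<bar>real n * mu_max B - 2 * \<alpha> * real m\<bar> \<le> sqrt ?R"
      "\<bar>real n * mu_min B - 2 * \<alpha> * real m\<bar> \<le> sqrt ?R"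
    using bound by auto
  then show ?thesis
    unfolding B_def[symmetric] using assms(2)
    by (simp add: pos_le_divide_eq pos_divide_le_eq abs_le_iff mult.commute[of "real n"])
qed

end
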